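(* Let $G$ be a graph with at least one edge, and let $\delta = \operatorname{emin}(G)$. Then, as $n \to \infty$, \[\operatorname{sat}(Q_n, G) \ge (\delta - 1 + o(1)) \cdot 2^{n-2}.\]
   Context: $Q_n$ is the $n$-dimensional hypercube: vertex set $\{0,1\}^n$, two vertices adjacent iff they differ in exactly one coordinate. For a host graph $H$ and a graph $G$, a subgraph $H'$ of $H$ is $(H,G)$-saturated if $H'$ contains no subgraph isomorphic to $G$, but adding any edge of $E(H)\setminus E(H')$ to $H'$ creates a subgraph isomorphic to $G$. The saturation number $\operatorname{sat}(H,G)$ is the minimum number of edges of an $(H,G)$-saturated subgraph of $H$. For a graph $G$, $\operatorname{emin}(G)$ is the minimum, over all edges $uv$ of $G$, of $\max(\deg_G u, \deg_G v)$. *)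

theory Defs
  imports Complex_Main "HOL-Library.Landau_Symbols"
begin

record 'a ugraph =
  verts :: "'a set"
  edges :: "'a set set"

definition simple_graph :: "'a ugraph \<Rightarrow> bool" where
  "simple_graph G \<longleftrightarrow> finite (verts G) \<and> (\<forall>e\<in>edges G. e \<subseteq> verts G \<and> card e = 2)"

definition subgraph :: "'a ugraph \<Rightarrow> 'a ugraph \<Rightarrow> bool" where
  "subgraph K H \<longleftrightarrow> simple_graph K \<and> verts K \<subseteq> verts H \<and> edges K \<subseteq> edges H"

definition isomorphic :: "'a ugraph \<Rightarrow> 'b ugraph \<Rightarrow> bool" where
  "isomorphic K G \<longleftrightarrow> (\<exists>f. bij_betw f (verts K) (verts G) \<and>
     (\<forall>u\<in>verts K. \<forall>v\<in>verts K. {u, v} \<in> edges K \<longleftrightarrow> {f u, f v} \<in> edges G))"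

definition contains_copy :: "'a ugraph \<Rightarrow> 'b ugraph \<Rightarrow> bool" where
  "contains_copy H G \<longleftrightarrow> (\<exists>K. subgraph K H \<and> isomorphic K G)"

definition add_edge :: "'a set \<Rightarrow> 'a ugraph \<Rightarrow> 'a ugraph" where
  "add_edge e H = H\<lparr>edges := insert e (edges H)\<rparr>"

text \<open>The subgraph \<open>H'\<close> is spanning, so that adding an edge of the host never adds a vertex.
  This matters only when \<open>G\<close> has isolated vertices.\<close>

definition saturated :: "'a ugraph \<Rightarrow> 'b ugraph \<Rightarrow> 'a ugraph \<Rightarrow> bool" where
  "saturated H G H' \<longleftrightarrow> subgraph H' H \<and> verts H' = verts H \<and> \<not> contains_copy H' G \<and>
     (\<forall>e\<in>edges H - edges H'. contains_copy (add_edge e H') G)"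

text \<open>If \<open>G\<close> has an edge, the minimum ranges over a nonempty set: see
  \<open>saturated_exists\<close> below.\<close>

definition sat :: "'a ugraph \<Rightarrow> 'b ugraph \<Rightarrow> nat" where
  "sat H G = (LEAST m. \<exists>H'. saturated H G H' \<and> card (edges H') = m)"

definition degree :: "'a ugraph \<Rightarrow> 'a \<Rightarrow> nat" where
  "degree G v = card {e \<in> edges G. v \<in> e}"

definition emin :: "'a ugraph \<Rightarrow> nat" where
  "emin G = Min ((\<lambda>e. Max (degree G ` e)) ` edges G)"

definition hypercube :: "nat \<Rightarrow> bool list ugraph" where
  "hypercube n =
     \<lparr>verts = {x. length x = n},
      edges = {{x, y} | x y. length x = n \<and> length y = n \<and> card {i. i < n \<and> x ! i \<noteq> y ! i} = 1}\<rparr>"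

lemma simple_graph_hypercube: "simple_graph (hypercube n)"
proof -
  have "finite {x :: bool list. length x = n}"
    using finite_lists_length_eq[of "UNIV :: bool set" n] by simp
  moreover have "x \<noteq> y" if "card {i. i < n \<and> x ! i \<noteq> y ! i} = 1" for x y :: "bool list"
    using that by (metis (mono_tags, lifting) card.empty empty_Collect_eq zero_neq_one)
  then have "card {x, y} = 2" if "card {i. i < n \<and> x ! i \<noteq> y ! i} = 1" for x y :: "bool list"
    using that by (metis card_2_iff)
  ultimately show ?thesis
    unfolding simple_graph_def hypercube_def by force
qed

lemma finite_edges: "simple_graph G \<Longrightarrow> finite (edges G)"
  unfolding simple_graph_def by (rule finite_subset[of _ "Pow (verts G)"]) auto

lemma contains_copy_edge:
  assumes "contains_copy H G" "simple_graph G" "edges G \<noteq> {}"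
  shows "edges H \<noteq> {}"
proof -
  obtain K f where K: "subgraph K H" "bij_betw f (verts K) (verts G)"
    and iff: "\<And>u v. u \<in> verts K \<Longrightarrow> v \<in> verts K \<Longrightarrow>
      {u, v} \<in> edges K \<longleftrightarrow> {f u, f v} \<in> edges G"
    using assms(1) unfolding contains_copy_def isomorphic_def by blast
  obtain e where e: "e \<in> edges G" "e \<subseteq> verts G" "card e = 2"
    using assms(2,3) unfolding simple_graph_def by blast
  obtain a b where "e = {a, b}"
    using e(3) unfolding card_2_iff by blast
  with e have ab: "{a, b} \<in> edges G" "a \<in> verts G" "b \<in> verts G"
    by simp_all
  have "f ` verts K = verts G"
    using K(2) by (rule bij_betw_imp_surj_on)
  with ab(2,3) obtain u v where uv: "u \<in> verts K" "v \<in> verts K" "f u = a" "f v = b"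
    by (metis imageE)
  have "{u, v} \<in> edges K"
    using iff[OF uv(1,2)] uv(3,4) ab(1) by simp
  then show ?thesis using K(1) unfolding subgraph_def by blast
qed

lemma saturated_exists:
  assumes H: "simple_graph H" and G: "simple_graph G" "edges G \<noteq> {}"
  shows "\<exists>H'. saturated H G H'"
proof -
  let ?g = "\<lambda>E. \<lparr>verts = verts H, edges = E\<rparr>"
  let ?F = "{E. E \<subseteq> edges H \<and> \<not> contains_copy (?g E) G}"
  have "finite ?F"
    by (rule finite_subset[of _ "Pow (edges H)"]) (auto simp: finite_edges[OF H])
  moreover have "\<not> contains_copy (?g {}) G"
    using contains_copy_edge[OF _ G, of "?g {}"] by (intro notI) simp
  then have "?F \<noteq> {}" by blast
  ultimately have "\<exists>E\<in>?F. \<forall>E'\<in>?F. E \<subseteq> E' \<longrightarrow> E = E'"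
    by (rule finite_has_maximal)
  then obtain E where EF: "E \<in> ?F" and max: "\<forall>E'\<in>?F. E \<subseteq> E' \<longrightarrow> E = E'"
    by (rule bexE)
  have E: "E \<subseteq> edges H" "\<not> contains_copy (?g E) G"
    using EF by simp_all
  have "contains_copy (?g (insert e E)) G" if "e \<in> edges H - E" for e
  proof (rule ccontr)
    assume "\<not> contains_copy (?g (insert e E)) G"
    then have "insert e E \<in> ?F" using E(1) that by simp
    with max have "E \<subseteq> insert e E \<longrightarrow> E = insert e E" by (rule bspec)
    then have "E = insert e E" using subset_insertI by (rule mp)
    then show False using that by (metis DiffD2 insertI1)
  qed
  moreover have "subgraph (?g E) H"
    using E(1) H by (auto simp: subgraph_def simple_graph_def)
  ultimately have "saturated H G (?g E)"
    using E(2) by (simp add: saturated_def add_edge_def)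
  then show ?thesis ..
qed

end

theory Submission
  imports Defs "HOL-Real_Asymp.Real_Asymp"
begin

text \<open>
  Call a vertex of a saturated subgraph \<open>H'\<close> of \<open>Q\<^sub>n\<close> small if its degree is below \<open>\<delta> - 1\<close>.
  A missing edge completes a copy of \<open>G\<close>, so one of its ends has degree at least \<open>\<delta> - 1\<close>:
  cube-adjacent small vertices are adjacent in \<open>H'\<close>. Hence a small vertex has fewer than \<open>\<delta>\<close>
  small cube neighbours, and counting the cube edges leaving the set \<open>S\<close> of small vertices gives
  \<open>(n - \<delta>) |S| \<le> n (2\<^sup>n - |S|)\<close>. So asymptotically at least half of the vertices have degree at
  least \<open>\<delta> - 1\<close>.
\<close>

lemma degree_isomorphic_le:
  assumes K: "simple_graph K" and G: "simple_graph G" and bij: "bij_betw f (verts K) (verts G)"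
    and iff: "\<And>u v. u \<in> verts K \<Longrightarrow> v \<in> verts K \<Longrightarrow>
      {u, v} \<in> edges K \<longleftrightarrow> {f u, f v} \<in> edges G"
    and u: "u \<in> verts K"
  shows "degree G (f u) \<le> degree K u"
proof -
  have "{e \<in> edges G. f u \<in> e} \<subseteq> (`) f ` {e \<in> edges K. u \<in> e}"
  proof
    fix e assume "e \<in> {e \<in> edges G. f u \<in> e}"
    then have e: "e \<in> edges G" "f u \<in> e" by auto
    then have "card e = 2" "e \<subseteq> verts G" using G by (auto simp: simple_graph_def)
    then obtain b where b: "e = {f u, b}" "b \<in> verts G"
      using e(2) by (auto simp: card_2_iff)
    then obtain w where w: "w \<in> verts K" "b = f w"
      using bij by (auto simp: bij_betw_def)
    then have "{u, w} \<in> edges K" using iff[OF u w(1)] e b by simp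
    then show "e \<in> (`) f ` {e \<in> edges K. u \<in> e}"
      using b w by (intro image_eqI[of _ _ "{u, w}"]) auto
  qed
  then show ?thesis
    unfolding degree_def using finite_edges[OF K]
    by (intro surj_card_le) auto
qed

lemma emin_le:
  assumes "simple_graph G" "{a, b} \<in> edges G"
  shows "emin G \<le> max (degree G a) (degree G b)"
proof -
  have "emin G \<le> Max (degree G ` {a, b})"
    unfolding emin_def using assms(2) finite_edges[OF assms(1)] by (intro Min_le imageI) auto
  then show ?thesis by simp
qed

lemma degree_add_edge_le:
  assumes "simple_graph H"
  shows "degree (add_edge e H) u \<le> Suc (degree H u)"
proof -
  have "{d \<in> edges (add_edge e H). u \<in> d} \<subseteq> insert e {d \<in> edges H. u \<in> d}"
    by (auto simp: add_edge_def)
  then have "degree (add_edge e H) u \<le> card (insert e {d \<in> edges H. u \<in> d})"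
    unfolding degree_def using finite_edges[OF assms] by (intro card_mono) auto
  also have "\<dots> \<le> Suc (degree H u)"
    unfolding degree_def by (rule card_insert_le_m1) auto
  finally show ?thesis .
qed

text \<open>The copy of \<open>G\<close> created by adding \<open>{u, v}\<close> must use that edge,
  since otherwise it would already lie in \<open>H'\<close>. So \<open>{f u, f v}\<close> is an edge
  of \<open>G\<close>, one of its ends has degree at least \<open>emin G\<close>, and the added edge
  accounts for at most one unit of that degree. Writing \<open>Suc\<close> on the right avoids
  truncated subtraction.\<close>

lemma saturated_missing_edge:
  assumes G: "simple_graph G" and sat: "saturated H G H'"
    and e: "{u, v} \<in> edges H - edges H'"
  shows "emin G \<le> Suc (max (degree H' u) (degree H' v))"
proof -
  let ?A = "add_edge {u, v} H'"
  have H': "simple_graph H'" and nc: "\<not> contains_copy H' G"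
    using sat by (auto simp: saturated_def subgraph_def)
  have "contains_copy ?A G" using sat e by (simp add: saturated_def)
  then obtain K f where K: "subgraph K ?A" and bij: "bij_betw f (verts K) (verts G)"
    and iff: "\<And>u v. u \<in> verts K \<Longrightarrow> v \<in> verts K \<Longrightarrow>
      {u, v} \<in> edges K \<longleftrightarrow> {f u, f v} \<in> edges G"
    unfolding contains_copy_def isomorphic_def by blast
  have sK: "simple_graph K" using K by (simp add: subgraph_def)
  have uvK: "{u, v} \<in> edges K"
  proof (rule ccontr)
    assume "{u, v} \<notin> edges K"
    then have "subgraph K H'" using K by (auto simp: subgraph_def add_edge_def)
    then show False
      using nc bij iff unfolding contains_copy_def isomorphic_def by blast
  qed
  then have uv: "u \<in> verts K" "v \<in> verts K" using sK by (auto simp: simple_graph_def)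
  have fin: "finite (edges ?A)" using finite_edges[OF H'] by (simp add: add_edge_def)
  have deg: "degree G (f w) \<le> Suc (degree H' w)" if "w \<in> verts K" for w
  proof -
    have "degree G (f w) \<le> degree K w"
      using degree_isomorphic_le[OF sK G bij iff that] .
    also have "\<dots> \<le> degree ?A w"
      unfolding degree_def using K fin by (intro card_mono) (auto simp: subgraph_def)
    also have "\<dots> \<le> Suc (degree H' w)" by (rule degree_add_edge_le[OF H'])
    finally show ?thesis .
  qed
  have "emin G \<le> max (degree G (f u)) (degree G (f v))"
    using emin_le[OF G] uvK iff[OF uv] by simp
  then show ?thesis using deg[OF uv(1)] deg[OF uv(2)] by linarith
qed

lemma sum_degree:
  assumes "simple_graph H"
  shows "(\<Sum>v\<in>verts H. degree H v) = 2 * card (edges H)"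
  unfolding degree_def
proof (rule sum_multicount)
  show "\<forall>e\<in>edges H. card {v \<in> verts H. v \<in> e} = 2"
  proof
    fix e assume "e \<in> edges H"
    moreover from this have "{v \<in> verts H. v \<in> e} = e"
      using assms by (auto simp: simple_graph_def)
    ultimately show "card {v \<in> verts H. v \<in> e} = 2"
      using assms by (simp add: simple_graph_def)
  qed
qed (use assms finite_edges in \<open>auto simp: simple_graph_def\<close>)

definition flip :: "nat \<Rightarrow> bool list \<Rightarrow> bool list" where
  "flip i x = x[i := \<not> x ! i]"

lemma length_flip [simp]: "length (flip i x) = length x"
  by (simp add: flip_def)

text \<open>Out of range, \<open>flip\<close> is the identity, so it is an involution for every
  index and thus injective with no length condition.\<close>

lemma flip_flip [simp]: "flip i (flip i x) = x"
  by (cases "i < length x") (simp_all add: flip_def list_update_beyond)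

lemma flip_edge:
  assumes "length x = n" "i < n"
  shows "{x, flip i x} \<in> edges (hypercube n)"
proof -
  have "{j. j < n \<and> x ! j \<noteq> flip i x ! j} = {i}"
    using assms by (auto simp: flip_def nth_list_update)
  then have "card {j. j < n \<and> x ! j \<noteq> flip i x ! j} = 1" by simp
  then show ?thesis
    unfolding hypercube_def ugraph.simps mem_Collect_eq
    using assms by (intro exI[of _ x] exI[of _ "flip i x"] conjI) simp_all
qed

lemma flip_nth_iff:
  "i < length x \<Longrightarrow> j < length x \<Longrightarrow> flip i x ! j = (if i = j then \<not> x ! j else x ! j)"
  by (simp add: flip_def)

text \<open>Turns a count of directions at \<open>x\<close> into a count of edges at
  \<open>x\<close>.\<close>

lemma inj_on_flip_edge: "inj_on (\<lambda>i. {x, flip i x}) {..<length x}"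
proof (rule inj_onI)
  fix i j assume ij: "i \<in> {..<length x}" "j \<in> {..<length x}" "{x, flip i x} = {x, flip j x}"
  then have "flip i x = flip j x" by (auto simp: doubleton_eq_iff)
  then have "flip i x ! i = flip j x ! i" by simp
  then show "i = j" using ij by (auto simp: flip_nth_iff split: if_splits)
qed

text \<open>Two estimates for the number of vertices outside \<open>S\<close> are combined: a lower
  one from the cube edges leaving \<open>S\<close>, an upper one from the degree sum. Denominators
  are cleared.\<close>

lemma saturated_hypercube_card_ge:
  assumes G: "simple_graph G" and sat: "saturated (hypercube n) G H'" and n: "emin G < n"
  shows "(real (emin G) - 1) * (2 ^ n * (real n - real (emin G)))
    \<le> 2 * real (card (edges H')) * (2 * real n - real (emin G))"
proof -
  define \<delta> where "\<delta> = emin G"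
  define V where "V = {x :: bool list. length x = n}"
  define S where "S = {x \<in> V. Suc (degree H' x) < \<delta>}"
  have H': "simple_graph H'" and vH': "verts H' = V"
    using sat by (auto simp: saturated_def subgraph_def hypercube_def V_def)
  have finV: "finite V" using H' vH' by (simp add: simple_graph_def)
  have cardV: "card V = 2 ^ n"
    using card_lists_length_eq[of "UNIV :: bool set" n] by (simp add: V_def)
  have S: "S \<subseteq> V" "finite S" using finV by (auto simp: S_def)
  have inner: "card {i. i < n \<and> flip i x \<in> S} \<le> \<delta>" if x: "x \<in> S" for x
  proof -
    have len: "length x = n" using x by (simp add: S_def V_def)
    have "{x, flip i x} \<in> edges H'" if "i < n" "flip i x \<in> S" for i
    proof (rule ccontr)
      assume "{x, flip i x} \<notin> edges H'"
      then have "\<delta> \<le> Suc (max (degree H' x) (degree H' (flip i x)))"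
        unfolding \<delta>_def using flip_edge[OF len that(1)]
        by (intro saturated_missing_edge[OF G sat]) simp
      then show False using x that by (auto simp: S_def)
    qed
    then have "card {i. i < n \<and> flip i x \<in> S} \<le> degree H' x"
      unfolding degree_def using finite_edges[OF H'] inj_on_flip_edge[of x] len
      by (intro card_inj_on_le[where f = "\<lambda>i. {x, flip i x}"]) (auto intro: inj_on_subset)
    also have "\<dots> \<le> \<delta>" using x by (simp add: S_def)
    finally show ?thesis .
  qed
  have outer: "n - \<delta> \<le> card {i \<in> {..<n}. flip i x \<notin> S}" if x: "x \<in> S" for x
  proof -
    have "n = card ({i. i < n \<and> flip i x \<in> S} \<union> {i \<in> {..<n}. flip i x \<notin> S})"
      by (rule trans[OF card_lessThan[symmetric]], rule arg_cong[where f = card]) auto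
    also have "\<dots> \<le> card {i. i < n \<and> flip i x \<in> S} + card {i \<in> {..<n}. flip i x \<notin> S}"
      by (rule card_Un_le)
    finally show ?thesis using inner[OF x] by linarith
  qed
  \<comment> \<open>Double count of the pairs \<open>(x, i)\<close> with \<open>x\<close> in
    \<open>S\<close> and \<open>flip i x\<close> outside, first by vertex, then by direction. For a
    fixed \<open>i\<close>, \<open>flip i\<close> is injective, so each vertex outside
    \<open>S\<close> is hit at most once.\<close>
  have "card S * (n - \<delta>) \<le> (\<Sum>x\<in>S. card {i \<in> {..<n}. flip i x \<notin> S})"
    using sum_bounded_below[of S "n - \<delta>", OF outer] by simp
  also have "\<dots> = (\<Sum>i<n. card {x \<in> S. flip i x \<notin> S})"
    using S by (intro sum_multicount_gen) auto
  also have "\<dots> \<le> (\<Sum>i<n. card (V - S))"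
  proof (rule sum_mono)
    fix i
    have "inj_on (flip i) {x \<in> S. flip i x \<notin> S}"
      by (rule inj_on_inverseI[of _ "flip i"]) simp
    then show "card {x \<in> S. flip i x \<notin> S} \<le> card (V - S)"
      using finV S by (intro card_inj_on_le[where f = "flip i"]) (auto simp: V_def)
  qed
  finally have "card S * (n - \<delta>) \<le> n * card (V - S)" by simp
  then have "real (card S) * (real n - real \<delta>) \<le> real n * real (card (V - S))"
    using n by (simp add: \<delta>_def flip: of_nat_mult of_nat_diff)
  moreover have "real (card S) = 2 ^ n - real (card (V - S))"
    using card_Diff_subset[OF S(2,1)] card_mono[OF finV S(1)] cardV by (simp add: of_nat_diff)
  ultimately have big: "2 ^ n * (real n - real \<delta>) \<le> real (card (V - S)) * (2 * real n - real \<delta>)"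
    by (simp add: algebra_simps)
  \<comment> \<open>Here \<open>\<delta> - 1\<close> is truncated; it exceeds
    \<open>real \<delta> - 1\<close> only for \<open>\<delta> = 0\<close>, which makes the passage
    to reals safe.\<close>
  have "card (V - S) * (\<delta> - 1) \<le> (\<Sum>x\<in>V - S. degree H' x)"
    using sum_bounded_below[of "V - S" "\<delta> - 1" "degree H'"] by (fastforce simp: S_def)
  also have "\<dots> \<le> (\<Sum>x\<in>V. degree H' x)"
    using finV by (intro sum_mono2) auto
  also have "\<dots> = 2 * card (edges H')" using sum_degree[OF H'] vH' by simp
  finally have "real (card (V - S)) * real (\<delta> - 1) \<le> 2 * real (card (edges H'))"
    by (simp flip: of_nat_mult)
  moreover have "real (card (V - S)) * (real \<delta> - 1) \<le> real (card (V - S)) * real (\<delta> - 1)"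
    by (intro mult_left_mono) auto
  ultimately have edges: "real (card (V - S)) * (real \<delta> - 1) \<le> 2 * real (card (edges H'))"
    by linarith
  show ?thesis
  \<comment> \<open>Multiplying \<open>big\<close> by \<open>real \<delta> - 1\<close> needs a
    nonnegative factor. For \<open>\<delta> = 0\<close> the left side is nonpositive and the right
    side is not negative.\<close>
  proof (cases "\<delta> = 0")
    case True
    then have "(real (emin G) - 1) * (2 ^ n * (real n - real (emin G))) \<le> 0"
      by (simp add: \<delta>_def)
    also have "0 \<le> 2 * real (card (edges H')) * (2 * real n - real (emin G))"
      using n by simp
    finally show ?thesis .
  next
    case False
    have "(real \<delta> - 1) * (2 ^ n * (real n - real \<delta>))
        \<le> (real \<delta> - 1) * (real (card (V - S)) * (2 * real n - real \<delta>))"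
      using False big by (intro mult_left_mono) auto
    also have "\<dots> \<le> 2 * real (card (edges H')) * (2 * real n - real \<delta>)"
      using mult_right_mono[OF edges, of "2 * real n - real \<delta>"] n
      by (simp add: \<delta>_def mult_ac)
    finally show ?thesis by (simp add: \<delta>_def)
  qed
qed

theorem theorem2:
  fixes G :: "'a ugraph"
  assumes "simple_graph G" and "edges G \<noteq> {}"
  shows "\<exists>\<epsilon> :: nat \<Rightarrow> real. \<epsilon> \<in> o(\<lambda>_. 1) \<and>
    (\<forall>n. real (sat (hypercube n) G) \<ge> (real (emin G) - 1 + \<epsilon> n) * 2 powr (real n - 2))"
proof -
  define d where "d = real (emin G)"
  \<comment> \<open>The first branch solves
    \<open>d - 1 + \<epsilon> n = 2 * (d - 1) * (n - d) / (2 * n - d)\<close>, the factor that the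
    counting bound yields. The second makes the factor \<open>-1\<close>, so the bound is trivial
    for the finitely many small \<open>n\<close>, which do not affect the limit.\<close>
  define \<epsilon> where "\<epsilon> n = (if emin G < n then - (d - 1) * d / (2 * real n - d) else - d)" for n
  have lim: "(\<lambda>n. - (d - 1) * d / (2 * real n - d)) \<in> o(\<lambda>_. 1)"
    by real_asymp
  have "\<forall>\<^sub>F n in sequentially. \<epsilon> n = - (d - 1) * d / (2 * real n - d)"
    using eventually_gt_at_top[of "emin G"] by eventually_elim (simp add: \<epsilon>_def)
  then have "\<epsilon> \<in> o(\<lambda>_. 1)"
    using lim by (rule iffD2[OF landau_o.small.in_cong])
  moreover have "(d - 1 + \<epsilon> n) * 2 powr (real n - 2) \<le> real (sat (hypercube n) G)" for n
  proof (cases "emin G < n")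
    case True
    \<comment> \<open>Existence of a saturated subgraph ensures that the \<open>LEAST\<close> in
      \<open>sat\<close> is attained.\<close>
    have "\<exists>m H'. saturated (hypercube n) G H' \<and> card (edges H') = m"
      using saturated_exists[OF simple_graph_hypercube assms] by blast
    then have "\<exists>H'. saturated (hypercube n) G H' \<and> card (edges H') = sat (hypercube n) G"
      unfolding sat_def by (rule LeastI_ex)
    then obtain H' where H': "saturated (hypercube n) G H'"
      "card (edges H') = sat (hypercube n) G" by blast
    have pos: "2 * real n - d > 0" using True by (simp add: d_def)
    have bound: "(d - 1) * (2 ^ n * (real n - d)) \<le> 2 * real (sat (hypercube n) G) * (2 * real n - d)"
      using saturated_hypercube_card_ge[OF assms(1) H'(1) True] H'(2) by (simp add: d_def)
    have "d - 1 + \<epsilon> n = 2 * (d - 1) * (real n - d) / (2 * real n - d)"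
      using True pos by (simp add: \<epsilon>_def field_simps)
    \<comment> \<open>The divisor 4 reflects two halvings: about half of the vertices have large
      degree, and each edge is counted at both ends.\<close>
    moreover have "2 powr (real n - 2) = 2 ^ n / (4 :: real)"
      by (simp add: powr_diff powr_realpow)
    ultimately have "(d - 1 + \<epsilon> n) * 2 powr (real n - 2)
        = (d - 1) * (2 ^ n * (real n - d)) / (2 * (2 * real n - d))"
      using pos by (simp only:) (simp add: field_simps)
    also have "\<dots> \<le> real (sat (hypercube n) G)"
      using bound pos by (simp add: pos_divide_le_eq algebra_simps)
    finally show ?thesis .
  next
    case False
    then have "(d - 1 + \<epsilon> n) * 2 powr (real n - 2) \<le> 0" by (simp add: \<epsilon>_def)
    then show ?thesis by (rule order_trans) simp
  qed
  ultimately show ?thesis unfolding d_def by blast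
qed

end
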